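(* Let $p$ be a prime and let $M_*$ be a right $\mathcal A$-module equipped with a differential $\sigma\colon SM_*\to M_*$ that is a morphism of right $\mathcal A$-modules. The image and the kernel of the differential $\bar\sigma\colon S\,r_+(M_* )\to\operatorname{sh}_1r_+(M_* )$ are equal as filtered submodules of $r_+(M_* )$, and are explicitly given by $$\ker(\bar\sigma)=\operatorname{im}(\bar\sigma)=\langle t^r\otimes x-ut^r\otimes\sigma(x)\mid r\in\mathbb Z,\ x\in M_*\rangle .$$ Similarly, the image and the kernel of the completed differential $\bar\sigma\colon S\,R_+(M_* )\to\operatorname{sh}_1R_+(M_* )$ are equal, and are explicitly given by the completion of the subspace $\langle t^r\otimes x-ut^r\otimes\sigma(x)\mid r\in\mathbb Z,\ x\in M_*\rangle$ of $r_+(M_* )$ with respect to the Tate filtration.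
   Context: $\mathcal A$ is the mod $p$ Steenrod algebra. $S$ denotes left suspension, $(SP_* )_q=P_{q-1}$ with $F_n(SP_* )=S(F_nP_* )$ and, for $\mathcal A$-modules, $(Sx)\cdot a=(-1)^{|a|}S(x\cdot a)$; thus $\sigma$ has degree $+1$, $\sigma^2=0$ and $\sigma(x)\cdot a=(-1)^{|a|}\sigma(x\cdot a)$. For a filtered graded vector space $P_*$, $\operatorname{sh}_aP_*$ is the same vector space with $F_n(\operatorname{sh}_aP_* )=F_{n+a}P_*$. $r_+(M_* )=\hat H^{-*}(C_p;\mathbb F_p)\otimes M_*$, where $\hat H^{-*}(C_p;\mathbb F_p)=E(u)\otimes P(t^{\pm1})$ for $p$ odd and $P(u^{\pm1})$ for $p=2$, where one writes $t=u^2$; $|u|=-1$, $|t|=-2$. Its (Tate) filtration is $F_nr_+(M_* )=\langle u^it^r\otimes x\mid-i-2r-|x|(p-1)\le n\rangle$ ($i\in\{0,1\}$, $r\in\mathbb Z$), and $R_+(M_* )=\lim_nr_+(M_* )/F_nr_+(M_* )$. The differential $\bar\sigma$ on $r_+(M_* )$ is given by $$\bar\sigma(t^r\otimes x)=t^r\otimes\sigma(x),\qquad\bar\sigma(ut^r\otimes x)=t^r\otimes x-ut^r\otimes\sigma(x)$$ (for $p=2$: $\bar\sigma(u^{2r}\otimes x)=u^{2r}\otimes\sigma(x)$ and $\bar\sigma(u^{2r+1}\otimes x)=u^{2r}\otimes x+u^{2r+1}\otimes\sigma(x)$). It raises filtration by at most $1$ and so induces a differential, also denoted $\bar\sigma$,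 on $R_+(M_* )$. Filtration convention: for a filtered morphism $f\colon A\to B$, $F_n\operatorname{im}(f)=f(F_nA)$ and $F_n\ker(f)=\ker(f)\cap F_nA$. Image and kernel are compared inside $\operatorname{sh}_1r_+(M_* )$, so that equality as filtered objects means $\bar\sigma(F_nr_+(M_* ))=\ker(\bar\sigma)\cap F_{n+1}r_+(M_* )$ for all $n$. *)

theory Defs
  imports
    "HOL-Library.Poly_Mapping"
    "Berlekamp_Zassenhaus.Finite_Field"
begin

text \<open>Throughout, the prime is \<open>p = CARD('p)\<close> with \<open>'p :: prime_card\<close>, and the field with \<open>p\<close>
  elements is \<open>'p mod_ring\<close>.\<close>

section \<open>The mod p Steenrod algebra\<close>

text \<open>For \<open>p\<close> odd, \<open>Bock\<close> is the Bockstein and \<open>Pow i\<close> is the reduced power of degree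
  \<open>2i(p-1)\<close>.  For \<open>p = 2\<close>, \<open>Pow i\<close> is the Steenrod square of degree \<open>i\<close>, and \<open>Bock\<close> is a redundant
  generator, identified with \<open>Pow 1\<close> by a relation.\<close>

datatype steenrod_gen = Bock | Pow nat

datatype word = Word (letters: "steenrod_gen list")

text \<open>Words form a monoid under concatenation, written additively, so that \<open>word \<Rightarrow>\<^sub>0 'p mod_ring\<close>
  with its convolution product is the free associative algebra on the generators.\<close>

instantiation word :: monoid_add
begin
definition zero_word :: word where "0 = Word []"
definition plus_word :: "word \<Rightarrow> word \<Rightarrow> word" where "v + w = Word (letters v @ letters w)"
instance by standard (auto simp: zero_word_def plus_word_def)
end

type_synonym 'p free_steenrod = "word \<Rightarrow>\<^sub>0 'p mod_ring"

definition free_const :: "'p::prime_card mod_ring \<Rightarrow> 'p free_steenrod" where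
  "free_const c = Poly_Mapping.single 0 c"

definition bock :: "'p::prime_card free_steenrod" where
  "bock = Poly_Mapping.single (Word [Bock]) 1"

definition redpow :: "nat \<Rightarrow> 'p::prime_card free_steenrod" where
  "redpow i = Poly_Mapping.single (Word [Pow i]) 1"

text \<open>In all the binomial coefficients below the subtractions are exact in the range of
  summation.\<close>

definition adem_two :: "'p::prime_card free_steenrod set" where
  "adem_two =
    {bock - redpow 1} \<union>
    {redpow a * redpow b
       - (\<Sum>j=0..a div 2. of_nat ((b - 1 - j) choose (a - 2 * j)) * redpow (a + b - j) * redpow j)
     | a b. 0 < a \<and> a < 2 * b}"

definition adem_odd :: "'p::prime_card free_steenrod set" where
  "adem_odd = (let p = CARD('p) in
    {bock * bock} \<union>
    {redpow a * redpow b
       - (\<Sum>j=0..a div p. (-1) ^ (a + j) * of_nat (((p - 1) * (b - j) - 1) choose (a - p * j))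
            * redpow (a + b - j) * redpow j)
     | a b. 0 < a \<and> a < p * b} \<union>
    {redpow a * bock * redpow b
       - (\<Sum>j=0..a div p. (-1) ^ (a + j) * of_nat (((p - 1) * (b - j)) choose (a - p * j))
            * bock * redpow (a + b - j) * redpow j)
       - (\<Sum>j=0..(a - 1) div p.
            (-1) ^ (a + j + 1) * of_nat (((p - 1) * (b - j) - 1) choose (a - p * j - 1))
            * redpow (a + b - j) * bock * redpow j)
     | a b. 0 < a \<and> a \<le> p * b})"

definition steenrod_relations :: "'p::prime_card free_steenrod set" where
  "steenrod_relations = insert (redpow 0 - 1) (if CARD('p) = 2 then adem_two else adem_odd)"

inductive_set two_sided_ideal :: "'r::ring_1 set \<Rightarrow> 'r set" for R where
  zero: "0 \<in> two_sided_ideal R"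
| gen: "r \<in> R \<Longrightarrow> a * r * b \<in> two_sided_ideal R"
| add: "x \<in> two_sided_ideal R \<Longrightarrow> y \<in> two_sided_ideal R \<Longrightarrow> x + y \<in> two_sided_ideal R"

lemma two_sided_ideal_mult_left: "x \<in> two_sided_ideal R \<Longrightarrow> c * x \<in> two_sided_ideal R"
proof (induction rule: two_sided_ideal.induct)
  case zero then show ?case by (simp add: two_sided_ideal.zero)
next
  case (gen r a b)
  then show ?case using two_sided_ideal.gen[of r R "c * a" b] by (simp add: mult.assoc)
next
  case (add x y) then show ?case by (simp add: distrib_left two_sided_ideal.add)
qed

lemma two_sided_ideal_mult_right: "x \<in> two_sided_ideal R \<Longrightarrow> x * c \<in> two_sided_ideal R"
proof (induction rule: two_sided_ideal.induct)
  case zero then show ?case by (simp add: two_sided_ideal.zero)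
next
  case (gen r a b)
  then show ?case using two_sided_ideal.gen[of r R a "b * c"] by (simp add: mult.assoc)
next
  case (add x y) then show ?case by (simp add: distrib_right two_sided_ideal.add)
qed

lemma two_sided_ideal_uminus: "x \<in> two_sided_ideal R \<Longrightarrow> - x \<in> two_sided_ideal R"
  using two_sided_ideal_mult_left[of x R "-1"] by simp

lemma two_sided_ideal_diff:
  "x \<in> two_sided_ideal R \<Longrightarrow> y \<in> two_sided_ideal R \<Longrightarrow> x - y \<in> two_sided_ideal R"
  using two_sided_ideal.add[OF _ two_sided_ideal_uminus] by fastforce

definition steenrod_rel :: "'p::prime_card free_steenrod \<Rightarrow> 'p free_steenrod \<Rightarrow> bool" where
  "steenrod_rel f g \<longleftrightarrow> f - g \<in> two_sided_ideal steenrod_relations"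

lemma equivp_steenrod_rel: "equivp steenrod_rel"
proof (rule equivpI)
  show "reflp steenrod_rel"
    by (rule reflpI) (simp add: steenrod_rel_def two_sided_ideal.zero)
  show "symp steenrod_rel"
    by (rule sympI, unfold steenrod_rel_def, drule two_sided_ideal_uminus) simp
  show "transp steenrod_rel"
    by (rule transpI, unfold steenrod_rel_def, drule (1) two_sided_ideal.add) simp
qed

quotient_type (overloaded) 'p steenrod = "'p::prime_card free_steenrod" / steenrod_rel
  by (rule equivp_steenrod_rel)

text \<open>The classes below do not require \<open>0 \<noteq> 1\<close>.\<close>

instantiation steenrod :: (prime_card) "{ring, monoid_mult}"
begin

lift_definition zero_steenrod :: "'a steenrod" is 0 .

lift_definition one_steenrod :: "'a steenrod" is 1 .

lift_definition plus_steenrod :: "'a steenrod \<Rightarrow> 'a steenrod \<Rightarrow> 'a steenrod" is "(+)"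
  unfolding steenrod_rel_def by (drule (1) two_sided_ideal.add) (simp add: algebra_simps)

lift_definition uminus_steenrod :: "'a steenrod \<Rightarrow> 'a steenrod" is uminus
  unfolding steenrod_rel_def by (drule two_sided_ideal_uminus) simp

lift_definition minus_steenrod :: "'a steenrod \<Rightarrow> 'a steenrod \<Rightarrow> 'a steenrod" is "(-)"
  unfolding steenrod_rel_def by (drule (1) two_sided_ideal_diff) (simp add: algebra_simps)

lift_definition times_steenrod :: "'a steenrod \<Rightarrow> 'a steenrod \<Rightarrow> 'a steenrod" is "(*)"
  unfolding steenrod_rel_def
  by (metis mult_diff_mult two_sided_ideal.add two_sided_ideal_mult_left two_sided_ideal_mult_right)

instance
  by standard (transfer; simp add: algebra_simps equivp_reflp[OF equivp_steenrod_rel])+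

end

lift_definition steenrod_const :: "'p::prime_card mod_ring \<Rightarrow> 'p steenrod" is free_const .

fun gen_degree :: "nat \<Rightarrow> steenrod_gen \<Rightarrow> nat" where
  "gen_degree p Bock = 1"
| "gen_degree p (Pow i) = (if p = 2 then i else 2 * i * (p - 1))"

definition word_degree :: "nat \<Rightarrow> word \<Rightarrow> nat" where
  "word_degree p w = sum_list (map (gen_degree p) (letters w))"

text \<open>The homogeneous part of degree \<open>k\<close>.\<close>

definition steenrod_part :: "nat \<Rightarrow> 'p::prime_card steenrod set" where
  "steenrod_part k = abs_steenrod ` {f. \<forall>w \<in> Poly_Mapping.keys f. word_degree CARD('p) w = k}"


section \<open>Right modules over the Steenrod algebra\<close>

text \<open>A graded vector space is an ambient vector space \<open>'m\<close> that is the internal direct sum of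
  subspaces \<open>M n\<close>, \<open>n \<in> \<int>\<close>; the whole of \<open>'m\<close> is the space of finite sums of homogeneous elements.
  As for homology, operations act from the right and lower degrees.  The unit law is \<open>act_const\<close>
  with \<open>c = 1\<close>.\<close>

locale right_steenrod_module =
  vector_space scale
  for scale :: "'p::prime_card mod_ring \<Rightarrow> 'm::ab_group_add \<Rightarrow> 'm" +
  fixes M :: "int \<Rightarrow> 'm set"
    and act :: "'m \<Rightarrow> 'p steenrod \<Rightarrow> 'm"
  assumes subspace_part: "subspace (M n)"
    and direct_sum: "\<exists>!f :: int \<Rightarrow>\<^sub>0 'm.
          (\<forall>n. Poly_Mapping.lookup f n \<in> M n) \<and>
          x = (\<Sum>n \<in> Poly_Mapping.keys f. Poly_Mapping.lookup f n)"
    and act_add_left: "act (x + y) a = act x a + act y a"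
    and act_add_right: "act x (a + b) = act x a + act x b"
    and act_scale: "act (scale c x) a = scale c (act x a)"
    and act_const: "act x (steenrod_const c) = scale c x"
    and act_mult: "act x (a * b) = act (act x a) b"
    and act_degree: "x \<in> M n \<Longrightarrow> a \<in> steenrod_part k \<Longrightarrow> act x a \<in> M (n - int k)"

text \<open>A differential, that is, a morphism of right modules from the suspension of \<open>M\<close> to \<open>M\<close>,
  regarded as a map \<open>\<sigma>\<close> of degree \<open>+1\<close> on \<open>M\<close>; the sign comes from the action on the suspension.\<close>

locale steenrod_module_with_differential =
  right_steenrod_module scale M act
  for scale :: "'p::prime_card mod_ring \<Rightarrow> 'm::ab_group_add \<Rightarrow> 'm"
    and M :: "int \<Rightarrow> 'm set"
    and act :: "'m \<Rightarrow> 'p steenrod \<Rightarrow> 'm" +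
  fixes \<sigma> :: "'m \<Rightarrow> 'm"
  assumes linear_\<sigma>: "Vector_Spaces.linear scale scale \<sigma>"
    and \<sigma>_degree: "x \<in> M n \<Longrightarrow> \<sigma> x \<in> M (n + 1)"
    and \<sigma>_\<sigma>: "\<sigma> (\<sigma> x) = 0"
    and \<sigma>_act: "a \<in> steenrod_part k \<Longrightarrow> act (\<sigma> x) a = scale ((-1) ^ k) (\<sigma> (act x a))"


section \<open>The Tate construction\<close>

text \<open>The monomial basis of the Tate cohomology of the cyclic group of order \<open>p\<close>: \<open>T r\<close> is
  \<open>t\<^sup>r\<close> and \<open>UT r\<close> is \<open>u t\<^sup>r\<close>.  For \<open>p = 2\<close> they are the powers of \<open>u\<close> with exponents \<open>2r\<close> and
  \<open>2r + 1\<close>.\<close>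

datatype tate_monomial = T int | UT int

fun monomial_degree :: "tate_monomial \<Rightarrow> int" where
  "monomial_degree (T r) = - 2 * r"
| "monomial_degree (UT r) = - 1 - 2 * r"

text \<open>Since the monomials are a basis, the tensor product of Tate cohomology with \<open>M\<close> is the direct
  sum of copies of \<open>M\<close> indexed by monomials: finitely supported functions from monomials to
  \<open>'m\<close>.  This is justified by the universal property proved below.\<close>

type_synonym 'k tate_cohomology = "tate_monomial \<Rightarrow>\<^sub>0 'k"
type_synonym 'm tate = "tate_monomial \<Rightarrow>\<^sub>0 'm"

definition tate_scale :: "('k::field \<Rightarrow> 'm::ab_group_add \<Rightarrow> 'm) \<Rightarrow> 'k \<Rightarrow> 'm tate \<Rightarrow> 'm tate" where
  "tate_scale scale c f = Poly_Mapping.map (scale c) f"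

abbreviation tate_span :: "('k::field \<Rightarrow> 'm::ab_group_add \<Rightarrow> 'm) \<Rightarrow> 'm tate set \<Rightarrow> 'm tate set" where
  "tate_span scale \<equiv> module.span (tate_scale scale)"

definition tate_tensor ::
    "('k::field \<Rightarrow> 'm::ab_group_add \<Rightarrow> 'm) \<Rightarrow> 'k tate_cohomology \<Rightarrow> 'm \<Rightarrow> 'm tate" where
  "tate_tensor scale h x = (\<Sum>m \<in> Poly_Mapping.keys h.
     Poly_Mapping.single m (scale (Poly_Mapping.lookup h m) x))"

abbreviation monomial_tensor :: "tate_monomial \<Rightarrow> 'm::zero \<Rightarrow> 'm tate" (infix "\<otimes>\<^sub>m" 72) where
  "m \<otimes>\<^sub>m x \<equiv> Poly_Mapping.single m x"

lemma poly_mapping_sum_singles: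
  "(\<Sum>m \<in> Poly_Mapping.keys f. Poly_Mapping.single m (Poly_Mapping.lookup f m)) = f"
  by (rule poly_mapping_eqI)
    (simp add: lookup_sum lookup_single when_def in_keys_iff)

lemma sum_keys_superset:
  fixes g :: "'i \<Rightarrow> 'm::zero \<Rightarrow> 'v::comm_monoid_add"
  assumes "finite S" "Poly_Mapping.keys f \<subseteq> S" "\<And>m. g m 0 = 0"
  shows "(\<Sum>m \<in> Poly_Mapping.keys f. g m (Poly_Mapping.lookup f m)) =
    (\<Sum>m \<in> S. g m (Poly_Mapping.lookup f m))"
  using assms by (intro sum.mono_neutral_left) (auto simp: in_keys_iff)

lemma sum_keys_add:
  fixes g :: "'i \<Rightarrow> 'm::ab_group_add \<Rightarrow> 'v::ab_group_add"
  assumes add: "\<And>m x y. g m (x + y) = g m x + g m y"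
  shows "(\<Sum>m \<in> Poly_Mapping.keys (f + f'). g m (Poly_Mapping.lookup (f + f') m)) =
    (\<Sum>m \<in> Poly_Mapping.keys f. g m (Poly_Mapping.lookup f m)) +
    (\<Sum>m \<in> Poly_Mapping.keys f'. g m (Poly_Mapping.lookup f' m))"
proof -
  let ?S = "Poly_Mapping.keys f \<union> Poly_Mapping.keys f'"
  have z: "g m 0 = 0" for m
    using add[of m 0 0] by simp
  have "Poly_Mapping.keys (f + f') \<subseteq> ?S"
    by (rule Poly_Mapping.keys_add)
  then show ?thesis
    by (subst (1 2 3) sum_keys_superset[of ?S _ g, OF _ _ z])
      (auto simp: add lookup_add sum.distrib)
qed

context vector_space
begin

lemma lookup_tate_scale [simp]:
  "Poly_Mapping.lookup (tate_scale scale c f) m = scale c (Poly_Mapping.lookup f m)"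
  by (simp add: tate_scale_def Poly_Mapping.map.rep_eq when_def)

lemma vector_space_tate: "vector_space (tate_scale scale)"
  by standard
    (auto intro!: poly_mapping_eqI simp: lookup_add scale_right_distrib scale_left_distrib)

lemma tate_tensor_monomial: "tate_tensor scale (Poly_Mapping.single m 1) x = m \<otimes>\<^sub>m x"
  by (simp add: tate_tensor_def)

lemma lookup_tate_tensor:
  "Poly_Mapping.lookup (tate_tensor scale h x) m = scale (Poly_Mapping.lookup h m) x"
  by (simp add: tate_tensor_def lookup_sum lookup_single when_def in_keys_iff)

lemma tate_tensor_universal:
  fixes s :: "'a \<Rightarrow> 'v::ab_group_add \<Rightarrow> 'v" and B :: "'a tate_cohomology \<Rightarrow> 'b \<Rightarrow> 'v"
  assumes "vector_space s"
    and B_left: "\<And>x. Vector_Spaces.linear (\<lambda>c. Poly_Mapping.map ((*) c)) s (\<lambda>h. B h x)"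
    and B_right: "\<And>h. Vector_Spaces.linear scale s (B h)"
  shows "\<exists>!L. Vector_Spaces.linear (tate_scale scale) s L \<and> (\<forall>h x. L (tate_tensor scale h x) = B h x)"
proof -
  interpret V: vector_space s by fact
  interpret T: vector_space "tate_scale scale" by (rule vector_space_tate)
  let ?e = "\<lambda>m. Poly_Mapping.single m 1 :: 'a tate_cohomology"
  define L where "L f = (\<Sum>m \<in> Poly_Mapping.keys f. B (?e m) (Poly_Mapping.lookup f m))" for f
  have Br_add: "B h (x + y) = B h x + B h y" and Br_scale: "B h (scale c x) = s c (B h x)"
    for h x y c
    using B_right[of h] by (simp_all add: Vector_Spaces.linear_iff)
  have Br0: "B h 0 = 0" for h
    using Br_add[of h 0 0] by simp
  have Bl_add: "B (h + h') x = B h x + B h' x"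
    and Bl_scale: "B (Poly_Mapping.map ((*) c) h) x = s c (B h x)" for h h' x c
    using B_left[of x] by (simp_all add: Vector_Spaces.linear_iff)
  have Bl0: "B 0 x = 0" for x
    using Bl_add[of 0 0 x] by simp
  have Bl_sum: "B (\<Sum>i \<in> I. f i) x = (\<Sum>i \<in> I. B (f i) x)" for f and I :: "tate_monomial set" and x
    by (induction I rule: infinite_finite_induct) (auto simp: Bl0 Bl_add)
  have L_add: "L (f + g) = L f + L g" for f g
    unfolding L_def by (rule sum_keys_add) (rule Br_add)
  have L_scale: "L (tate_scale scale c f) = s c (L f)" for c f
  proof -
    have "Poly_Mapping.keys (tate_scale scale c f) \<subseteq> Poly_Mapping.keys f"
      by (auto simp: in_keys_iff)
    then have "L (tate_scale scale c f) =
        (\<Sum>m \<in> Poly_Mapping.keys f. B (?e m) (Poly_Mapping.lookup (tate_scale scale c f) m))"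
      unfolding L_def by (intro sum_keys_superset) (auto simp: Br0)
    then show ?thesis
      by (simp add: L_def Br_scale V.scale_sum_right)
  qed
  have L_lin: "Vector_Spaces.linear (tate_scale scale) s L"
    by (simp add: Vector_Spaces.linear_iff L_add L_scale assms(1) vector_space_tate)
  have L_tensor: "L (tate_tensor scale h x) = B h x" for h x
  proof -
    have "Poly_Mapping.keys (tate_tensor scale h x) \<subseteq> Poly_Mapping.keys h"
      by (auto simp: in_keys_iff lookup_tate_tensor)
    then have "L (tate_tensor scale h x) =
        (\<Sum>m \<in> Poly_Mapping.keys h. B (?e m) (Poly_Mapping.lookup (tate_tensor scale h x) m))"
      unfolding L_def by (intro sum_keys_superset) (auto simp: Br0)
    also have "\<dots> = (\<Sum>m \<in> Poly_Mapping.keys h. B (Poly_Mapping.map ((*) (Poly_Mapping.lookup h m)) (?e m)) x)"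
      by (simp only: lookup_tate_tensor Br_scale Bl_scale)
    also have "\<dots> = (\<Sum>m \<in> Poly_Mapping.keys h. B (Poly_Mapping.single m (Poly_Mapping.lookup h m)) x)"
      by (simp add: map_single)
    also have "\<dots> = B h x"
      by (simp flip: Bl_sum add: poly_mapping_sum_singles)
    finally show ?thesis .
  qed
  show ?thesis
  proof (rule ex1I[of _ L])
    fix L' assume L': "Vector_Spaces.linear (tate_scale scale) s L' \<and>
      (\<forall>h x. L' (tate_tensor scale h x) = B h x)"
    then interpret L': Vector_Spaces.linear "tate_scale scale" s L' by simp
    have "L' f = L f" for f
    proof -
      have "L' f = L' (\<Sum>m \<in> Poly_Mapping.keys f. m \<otimes>\<^sub>m Poly_Mapping.lookup f m)"
        by (simp add: poly_mapping_sum_singles)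
      also have "\<dots> = (\<Sum>m \<in> Poly_Mapping.keys f. L' (m \<otimes>\<^sub>m Poly_Mapping.lookup f m))"
        by (rule L'.sum)
      also have "\<dots> = L f"
        unfolding L_def using L' by (simp flip: tate_tensor_monomial)
      finally show ?thesis .
    qed
    then show "L' = L" by blast
  qed (use L_lin L_tensor in blast)
qed

end

definition tate_part ::
    "('p::prime_card mod_ring \<Rightarrow> 'm::ab_group_add \<Rightarrow> 'm) \<Rightarrow> (int \<Rightarrow> 'm set) \<Rightarrow> int \<Rightarrow> 'm tate set" where
  "tate_part scale M d =
    tate_span scale {m \<otimes>\<^sub>m x | m x k. x \<in> M k \<and> monomial_degree m + k = d}"

definition tate_filtration ::
    "('p::prime_card mod_ring \<Rightarrow> 'm::ab_group_add \<Rightarrow> 'm) \<Rightarrow> (int \<Rightarrow> 'm set) \<Rightarrow> int \<Rightarrow> 'm tate set" where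
  "tate_filtration scale M n =
    tate_span scale {m \<otimes>\<^sub>m x | m x k.
      x \<in> M k \<and> monomial_degree m - k * (int CARD('p) - 1) \<le> n}"

text \<open>The signs are those for \<open>p\<close> odd; for \<open>p = 2\<close> they are irrelevant.\<close>

fun sigma_bar_monomial :: "('m::ab_group_add \<Rightarrow> 'm) \<Rightarrow> tate_monomial \<Rightarrow> 'm \<Rightarrow> 'm tate" where
  "sigma_bar_monomial \<sigma> (T r) x = T r \<otimes>\<^sub>m \<sigma> x"
| "sigma_bar_monomial \<sigma> (UT r) x = T r \<otimes>\<^sub>m x - UT r \<otimes>\<^sub>m \<sigma> x"

definition sigma_bar :: "('m::ab_group_add \<Rightarrow> 'm) \<Rightarrow> 'm tate \<Rightarrow> 'm tate" where
  "sigma_bar \<sigma> f =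
    (\<Sum>m \<in> Poly_Mapping.keys f. sigma_bar_monomial \<sigma> m (Poly_Mapping.lookup f m))"

lemma (in steenrod_module_with_differential) sigma_bar_monomial_tensor:
  "sigma_bar \<sigma> (m \<otimes>\<^sub>m x) = sigma_bar_monomial \<sigma> m x"
proof -
  have "\<sigma> 0 = 0"
    using linear_\<sigma> by (metis module_hom.zero module_hom_iff_linear)
  then show ?thesis
    by (cases "x = 0"; cases m) (simp_all add: sigma_bar_def)
qed

definition sigma_bar_cycles ::
    "('p::prime_card mod_ring \<Rightarrow> 'm::ab_group_add \<Rightarrow> 'm) \<Rightarrow> (int \<Rightarrow> 'm set) \<Rightarrow> ('m \<Rightarrow> 'm) \<Rightarrow> 'm tate set"
  where
  "sigma_bar_cycles scale M \<sigma> =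
    tate_span scale {T r \<otimes>\<^sub>m x - UT r \<otimes>\<^sub>m \<sigma> x | r x k. x \<in> M k}"


section \<open>Completion\<close>

definition coset_sum :: "'v::ab_group_add set \<Rightarrow> 'v set \<Rightarrow> 'v set" (infixl "\<oplus>\<^sub>c" 65) where
  "C \<oplus>\<^sub>c U = {v + u | v u. v \<in> C \<and> u \<in> U}"

text \<open>\<open>completion V F\<close> is the limit over \<open>n\<close> of \<open>V / (V \<inter> F n)\<close>, as compatible families of
  cosets.  The projection from \<open>V / (V \<inter> F n)\<close> to \<open>V / (V \<inter> F m)\<close>, for \<open>n \<le> m\<close>, sends a coset \<open>C\<close>
  to \<open>C \<oplus>\<^sub>c (V \<inter> F m)\<close>.\<close>

definition completion :: "'v::ab_group_add set \<Rightarrow> (int \<Rightarrow> 'v set) \<Rightarrow> (int \<Rightarrow> 'v set) set" where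
  "completion V F = {c.
     (\<forall>n. \<exists>v \<in> V. c n = {v} \<oplus>\<^sub>c (V \<inter> F n)) \<and>
     (\<forall>n m. n \<le> m \<longrightarrow> c m = c n \<oplus>\<^sub>c (V \<inter> F m))}"

definition completion_zero :: "'v::ab_group_add set \<Rightarrow> (int \<Rightarrow> 'v set) \<Rightarrow> int \<Rightarrow> 'v set" where
  "completion_zero V F = (\<lambda>n. V \<inter> F n)"

text \<open>The induced filtration: the kernels of the projections from the limit.\<close>

definition completion_filtration ::
    "'v::ab_group_add set \<Rightarrow> (int \<Rightarrow> 'v set) \<Rightarrow> int \<Rightarrow> (int \<Rightarrow> 'v set) set" where
  "completion_filtration V F n = {c \<in> completion V F. c n = V \<inter> F n}"

text \<open>The map of completions induced by a map \<open>f\<close> into \<open>V\<close> that raises filtration by at most \<open>s\<close>: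
  its component in \<open>V / (V \<inter> F n)\<close> comes from the component of index \<open>n - s\<close> in the source.\<close>

definition completion_map ::
    "('w \<Rightarrow> 'v::ab_group_add) \<Rightarrow> int \<Rightarrow> 'v set \<Rightarrow> (int \<Rightarrow> 'v set) \<Rightarrow> (int \<Rightarrow> 'w set) \<Rightarrow> int \<Rightarrow> 'v set" where
  "completion_map f s V F c = (\<lambda>n. (f ` c (n - s)) \<oplus>\<^sub>c (V \<inter> F n))"

text \<open>Limits of graded vector spaces are formed degreewise; \<open>R_plus scale M d\<close> is the part of
  degree \<open>d\<close>.\<close>

definition R_plus ::
    "('p::prime_card mod_ring \<Rightarrow> 'm::ab_group_add \<Rightarrow> 'm) \<Rightarrow> (int \<Rightarrow> 'm set) \<Rightarrow> int
      \<Rightarrow> (int \<Rightarrow> 'm tate set) set" where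
  "R_plus scale M d = completion (tate_part scale M d) (tate_filtration scale M)"

definition R_plus_filtration ::
    "('p::prime_card mod_ring \<Rightarrow> 'm::ab_group_add \<Rightarrow> 'm) \<Rightarrow> (int \<Rightarrow> 'm set) \<Rightarrow> int \<Rightarrow> int
      \<Rightarrow> (int \<Rightarrow> 'm tate set) set" where
  "R_plus_filtration scale M d =
    completion_filtration (tate_part scale M d) (tate_filtration scale M)"

text \<open>The completed differential from degree \<open>d - 1\<close> to degree \<open>d\<close>, that is, on the part of
  degree \<open>d\<close> of the suspension.\<close>

definition completed_sigma_bar ::
    "('p::prime_card mod_ring \<Rightarrow> 'm::ab_group_add \<Rightarrow> 'm) \<Rightarrow> (int \<Rightarrow> 'm set) \<Rightarrow> ('m \<Rightarrow> 'm) \<Rightarrow> int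
      \<Rightarrow> (int \<Rightarrow> 'm tate set) \<Rightarrow> int \<Rightarrow> 'm tate set" where
  "completed_sigma_bar scale M \<sigma> d =
    completion_map (sigma_bar \<sigma>) 1 (tate_part scale M d) (tate_filtration scale M)"

definition completed_kernel ::
    "('p::prime_card mod_ring \<Rightarrow> 'm::ab_group_add \<Rightarrow> 'm) \<Rightarrow> (int \<Rightarrow> 'm set) \<Rightarrow> ('m \<Rightarrow> 'm) \<Rightarrow> int
      \<Rightarrow> (int \<Rightarrow> 'm tate set) set" where
  "completed_kernel scale M \<sigma> d = {c \<in> R_plus scale M d.
     completed_sigma_bar scale M \<sigma> (d + 1) c =
     completion_zero (tate_part scale M (d + 1)) (tate_filtration scale M)}"

text \<open>The completion of the part of degree \<open>d\<close> of the span of the cycles, for the subspace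
  filtration, embedded in the completion of the whole by the map induced by the inclusion.\<close>

definition completed_cycles ::
    "('p::prime_card mod_ring \<Rightarrow> 'm::ab_group_add \<Rightarrow> 'm) \<Rightarrow> (int \<Rightarrow> 'm set) \<Rightarrow> ('m \<Rightarrow> 'm) \<Rightarrow> int
      \<Rightarrow> (int \<Rightarrow> 'm tate set) set" where
  "completed_cycles scale M \<sigma> d =
    completion_map id 0 (tate_part scale M d) (tate_filtration scale M) `
      completion (sigma_bar_cycles scale M \<sigma> \<inter> tate_part scale M d) (tate_filtration scale M)"

end

theory Submission
  imports Defs
begin

text \<open>The complex \<open>r\<^sub>+(M)\<close> is contractible, compatibly with degree and filtration.  Define
  \<open>h (t\<^sup>r \<otimes> x) = u t\<^sup>r \<otimes> x\<close> and \<open>h (u t\<^sup>r \<otimes> x) = 0\<close>.  Then \<open>\<sigma>\<^sub>b h + h \<sigma>\<^sub>b = 1\<close>, where \<open>\<sigma>\<^sub>b\<close> is the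
  differential (\<open>sigma_bar_homotopy\<close>), and \<open>h\<close> lowers both the degree and the Tate filtration by
  1, while \<open>\<sigma>\<^sub>b\<close> raises the degree by 1 and the filtration by at most 1.  Hence a cycle \<open>z\<close> in \<open>F\<^sub>n\<^sub>+\<^sub>1\<close> is the boundary of
  \<open>h z\<close>, which lies in \<open>F\<^sub>n\<close>; this is exactness in the filtered sense.  The image is spanned by the
  elements \<open>\<sigma>\<^sub>b (u t\<^sup>r \<otimes> x) = t\<^sup>r \<otimes> x - u t\<^sup>r \<otimes> \<sigma> x\<close>, because \<open>\<sigma>\<^sub>b (t\<^sup>r \<otimes> x) = \<sigma>\<^sub>b (u t\<^sup>r \<otimes> \<sigma> x)\<close>.

  Both \<open>\<sigma>\<^sub>b\<close> and \<open>h\<close> are filtered, so they induce maps of completions that still satisfy the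
  homotopy identity, and the same argument gives exactness there.  This step is carried out for an
  arbitrary filtered complex with such a contraction (locale \<open>filtered_contraction\<close>).  A point of the
  completion is handled through a coherent family of representatives of its cosets; the boundary of
  a coherent family is a coherent family of cycles, which identifies the image with the completion
  of the cycles.\<close>

section \<open>Completions by coherent families of representatives\<close>

definition additive_subgroup :: "'v::ab_group_add set \<Rightarrow> bool" where
  "additive_subgroup U \<longleftrightarrow> 0 \<in> U \<and> (\<forall>x \<in> U. \<forall>y \<in> U. x - y \<in> U)"

lemma additive_subgroupD:
  assumes "additive_subgroup U"
  shows "0 \<in> U" "x \<in> U \<Longrightarrow> y \<in> U \<Longrightarrow> x - y \<in> U" "x \<in> U \<Longrightarrow> - x \<in> U"
    "x \<in> U \<Longrightarrow> y \<in> U \<Longrightarrow> x + y \<in> U"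
proof -
  show zero: "0 \<in> U" and diff: "x \<in> U \<Longrightarrow> y \<in> U \<Longrightarrow> x - y \<in> U" for x y
    using assms by (auto simp: additive_subgroup_def)
  show minus: "x \<in> U \<Longrightarrow> - x \<in> U" for x
    using diff[OF zero, of x] by simp
  show "x \<in> U \<Longrightarrow> y \<in> U \<Longrightarrow> x + y \<in> U"
    using diff[OF _ minus, of x y] by simp
qed

lemma additive_subgroup_Int:
  "additive_subgroup U \<Longrightarrow> additive_subgroup W \<Longrightarrow> additive_subgroup (U \<inter> W)"
  by (simp add: additive_subgroup_def)

lemma mem_coset_iff: "w \<in> {v} \<oplus>\<^sub>c U \<longleftrightarrow> w - v \<in> U"
  unfolding coset_sum_def by (auto intro: exI[of _ "w - v"])

lemma coset_eq_iff:
  assumes "additive_subgroup U"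
  shows "{v} \<oplus>\<^sub>c U = {w} \<oplus>\<^sub>c U \<longleftrightarrow> v - w \<in> U"
proof
  assume "{v} \<oplus>\<^sub>c U = {w} \<oplus>\<^sub>c U"
  moreover have "v \<in> {v} \<oplus>\<^sub>c U"
    using additive_subgroupD(1)[OF assms] by (simp add: mem_coset_iff)
  ultimately show "v - w \<in> U"
    by (simp add: mem_coset_iff)
next
  assume vw: "v - w \<in> U"
  have "x - v \<in> U \<longleftrightarrow> x - w \<in> U" for x
    using additive_subgroupD(4)[OF assms _ vw, of "x - v"]
      additive_subgroupD(2)[OF assms _ vw, of "x - w"] by auto
  then show "{v} \<oplus>\<^sub>c U = {w} \<oplus>\<^sub>c U"
    by (auto simp: mem_coset_iff)
qed

lemma coset_zero: "{0} \<oplus>\<^sub>c U = U"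
  by (auto simp: mem_coset_iff)

text \<open>The image of a coset under an additive map, enlarged by a subgroup that contains the image of
  the direction, is again a coset.\<close>

lemma image_coset:
  assumes add: "\<And>x y. f (x + y) = f x + f y"
    and U: "additive_subgroup U" and U': "additive_subgroup U'"
    and f: "f ` U \<subseteq> U'"
  shows "f ` ({v} \<oplus>\<^sub>c U) \<oplus>\<^sub>c U' = {f v} \<oplus>\<^sub>c U'"
proof
  show "f ` ({v} \<oplus>\<^sub>c U) \<oplus>\<^sub>c U' \<subseteq> {f v} \<oplus>\<^sub>c U'"
  proof
    fix y assume "y \<in> f ` ({v} \<oplus>\<^sub>c U) \<oplus>\<^sub>c U'"
    then obtain u u' where "u \<in> U" "u' \<in> U'" "y = f (v + u) + u'"
      by (auto simp: coset_sum_def)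
    then show "y \<in> {f v} \<oplus>\<^sub>c U'"
      using f additive_subgroupD(4)[OF U'] by (auto simp: mem_coset_iff add)
  qed
  have "v \<in> {v} \<oplus>\<^sub>c U"
    using additive_subgroupD(1)[OF U] by (simp add: mem_coset_iff)
  then show "{f v} \<oplus>\<^sub>c U' \<subseteq> f ` ({v} \<oplus>\<^sub>c U) \<oplus>\<^sub>c U'"
    unfolding coset_sum_def by blast
qed

text \<open>A family \<open>v\<close> in \<open>V\<close> is coherent if its classes modulo the stages of an increasing filtration
  \<open>F\<close> are compatible; \<open>coset_family V F v\<close> is then the point of the completion that it represents.\<close>

definition coherent :: "'v::ab_group_add set \<Rightarrow> (int \<Rightarrow> 'v set) \<Rightarrow> (int \<Rightarrow> 'v) \<Rightarrow> bool" where
  "coherent V F v \<longleftrightarrow> range v \<subseteq> V \<and> (\<forall>n m. n \<le> m \<longrightarrow> v n - v m \<in> F m)"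

definition coset_family ::
    "'v::ab_group_add set \<Rightarrow> (int \<Rightarrow> 'v set) \<Rightarrow> (int \<Rightarrow> 'v) \<Rightarrow> int \<Rightarrow> 'v set" where
  "coset_family V F v = (\<lambda>n. {v n} \<oplus>\<^sub>c (V \<inter> F n))"

text \<open>A subgroup \<open>V\<close> of an ambient group with an increasing filtration \<open>F\<close> of the latter; \<open>V\<close> carries
  the filtration by the intersections \<open>V \<inter> F n\<close>.  The filtration need be neither separated nor
  exhaustive.\<close>

locale filtered_group =
  fixes V :: "'v::ab_group_add set" and F :: "int \<Rightarrow> 'v set"
  assumes subgroup_V: "additive_subgroup V"
    and subgroup_F: "additive_subgroup (F n)"
    and mono_F: "n \<le> m \<Longrightarrow> F n \<subseteq> F m"
begin

lemma subgroup_VF: "additive_subgroup (V \<inter> F n)"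
  by (intro additive_subgroup_Int subgroup_V subgroup_F)

lemma coset_family_eq_iff:
  assumes "range v \<subseteq> V" "range w \<subseteq> V"
  shows "coset_family V F v = coset_family V F w \<longleftrightarrow> (\<forall>n. v n - w n \<in> F n)"
  using assms additive_subgroupD(2)[OF subgroup_V]
  by (auto simp: coset_family_def fun_eq_iff coset_eq_iff[OF subgroup_VF])

lemma completion_eq: "completion V F = coset_family V F ` Collect (coherent V F)"
proof -
  have merge: "({x} \<oplus>\<^sub>c (V \<inter> F n)) \<oplus>\<^sub>c (V \<inter> F m) = {x} \<oplus>\<^sub>c (V \<inter> F m)" if "n \<le> m" for x n m
    using image_coset[of id "V \<inter> F n" "V \<inter> F m" x] mono_F[OF that] subgroup_VF by auto
  have compat: "(\<forall>n m. n \<le> m \<longrightarrow> coset_family V F v m = coset_family V F v n \<oplus>\<^sub>c (V \<inter> F m))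
      \<longleftrightarrow> coherent V F v" if v: "range v \<subseteq> V" for v
  proof -
    have "coset_family V F v m = coset_family V F v n \<oplus>\<^sub>c (V \<inter> F m) \<longleftrightarrow> v n - v m \<in> F m"
      if "n \<le> m" for n m
    proof -
      have "coset_family V F v m = coset_family V F v n \<oplus>\<^sub>c (V \<inter> F m) \<longleftrightarrow>
          {v n} \<oplus>\<^sub>c (V \<inter> F m) = {v m} \<oplus>\<^sub>c (V \<inter> F m)"
        by (auto simp: coset_family_def merge[OF that])
      also have "\<dots> \<longleftrightarrow> v n - v m \<in> V \<inter> F m"
        by (rule coset_eq_iff[OF subgroup_VF])
      also have "\<dots> \<longleftrightarrow> v n - v m \<in> F m"
        using v additive_subgroupD(2)[OF subgroup_V] by (simp add: image_subset_iff)
      finally show ?thesis .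
    qed
    then show ?thesis
      using v by (auto simp: coherent_def)
  qed
  show ?thesis
  proof (intro subset_antisym subsetI)
    fix c assume c: "c \<in> completion V F"
    then have "\<forall>n. \<exists>x \<in> V. c n = {x} \<oplus>\<^sub>c (V \<inter> F n)"
      by (simp add: completion_def)
    then obtain v where v: "\<And>n. v n \<in> V" "\<And>n. c n = {v n} \<oplus>\<^sub>c (V \<inter> F n)"
      by metis
    then have "range v \<subseteq> V" and cv: "c = coset_family V F v"
      by (auto simp: coset_family_def)
    then have "coherent V F v"
      using compat c by (simp add: completion_def)
    then show "c \<in> coset_family V F ` Collect (coherent V F)"
      using cv by simp
  next
    fix c assume "c \<in> coset_family V F ` Collect (coherent V F)"
    then obtain v where v: "coherent V F v" and cv: "c = coset_family V F v"
      by auto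
    then have "range v \<subseteq> V"
      by (simp add: coherent_def)
    then show "c \<in> completion V F"
      using v compat by (auto simp: completion_def cv coset_family_def)
  qed
qed

lemma coset_family_zero: "coset_family V F (\<lambda>_. 0) = completion_zero V F"
  by (simp add: coset_family_def completion_zero_def coset_zero)

lemma completion_filtration_iff:
  assumes "coherent V F v"
  shows "coset_family V F v \<in> completion_filtration V F n \<longleftrightarrow> v n \<in> F n"
proof -
  have "{v n} \<oplus>\<^sub>c (V \<inter> F n) = V \<inter> F n \<longleftrightarrow> v n \<in> V \<inter> F n"
    using coset_eq_iff[OF subgroup_VF, of "v n" n 0] by (simp add: coset_zero)
  then show ?thesis
    using assms
    by (auto simp: completion_filtration_def completion_eq coset_family_def coherent_def)
qed

end

text \<open>A filtered map applied to representatives represents the induced map of completions.\<close>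

lemma completion_map_coset_family:
  assumes "filtered_group V F" "filtered_group W G"
    and add: "\<And>x y. f (x + y) = f x + f y"
    and fV: "f ` V \<subseteq> W" and fF: "\<And>n. f ` (V \<inter> F n) \<subseteq> G (n + s)"
    and v: "coherent V F v"
  shows "completion_map f s W G (coset_family V F v) = coset_family W G (\<lambda>n. f (v (n - s)))"
    and "coherent W G (\<lambda>n. f (v (n - s)))"
proof -
  interpret V: filtered_group V F by fact
  interpret W: filtered_group W G by fact
  have "f ` (V \<inter> F (n - s)) \<subseteq> W \<inter> G n" for n
    using fV fF[of "n - s"] by auto
  then show "completion_map f s W G (coset_family V F v) = coset_family W G (\<lambda>n. f (v (n - s)))"
    by (simp add: completion_map_def coset_family_def
        image_coset[OF add V.subgroup_VF W.subgroup_VF])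
  have diff: "f (x - y) = f x - f y" for x y
    using add[of "x - y" y] by simp
  have "f (v (n - s)) - f (v (m - s)) \<in> G m" if "n \<le> m" for n m
  proof -
    have "v (n - s) - v (m - s) \<in> V \<inter> F (m - s)"
      using v that additive_subgroupD(2)[OF V.subgroup_V]
      by (simp add: coherent_def image_subset_iff)
    then show ?thesis
      using fF[of "m - s"] by (auto simp flip: diff)
  qed
  then show "coherent W G (\<lambda>n. f (v (n - s)))"
    using v fV by (simp add: coherent_def image_subset_iff)
qed


section \<open>Filtered complexes with a contraction\<close>

text \<open>A differential \<open>D\<close> on an ambient group, raising by 1 the degree, recorded by subgroups \<open>V d\<close>,
  and by at most 1 the filtration \<open>F\<close>; and a contracting homotopy \<open>H\<close> lowering both by 1.  The
  ambient group need not be the sum of the \<open>V d\<close>.\<close>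

locale filtered_contraction =
  fixes V :: "int \<Rightarrow> 'v::ab_group_add set" and F :: "int \<Rightarrow> 'v set" and D H :: "'v \<Rightarrow> 'v"
  assumes filtered: "filtered_group (V d) F"
    and D_add: "D (x + y) = D x + D y"
    and H_add: "H (x + y) = H x + H y"
    and D_degree: "D ` V d \<subseteq> V (d + 1)"
    and H_degree: "H ` V d \<subseteq> V (d - 1)"
    and D_filtration: "D ` F n \<subseteq> F (n + 1)"
    and H_filtration: "H ` F n \<subseteq> F (n - 1)"
    and D_D: "D (D x) = 0"
    and homotopy: "D (H x) + H (D x) = x"
begin

lemma D_zero: "D 0 = 0"
  using D_add[of 0 0] by simp

lemma H_zero: "H 0 = 0"
  using H_add[of 0 0] by simp

lemma D_H_cycle: "D z = 0 \<Longrightarrow> D (H z) = z"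
  using homotopy[of z] by (simp add: H_zero)

lemma cycles_eq_range: "{z. D z = 0} = range D"
  by (force simp: D_D intro: D_H_cycle[symmetric])

lemma image_filtration: "D ` F n = {z. D z = 0} \<inter> F (n + 1)"
proof
  show "D ` F n \<subseteq> {z. D z = 0} \<inter> F (n + 1)"
    using D_filtration by (auto simp: D_D)
  show "{z. D z = 0} \<inter> F (n + 1) \<subseteq> D ` F n"
    using H_filtration[of "n + 1"] by (force intro: D_H_cycle[symmetric])
qed

lemma completion_D:
  assumes "coherent (V (d - 1)) F v"
  shows "completion_map D 1 (V d) F (coset_family (V (d - 1)) F v) =
      coset_family (V d) F (\<lambda>n. D (v (n - 1)))"
    and "coherent (V d) F (\<lambda>n. D (v (n - 1)))"
proof -
  have "D ` V (d - 1) \<subseteq> V d" and "\<And>n. D ` (V (d - 1) \<inter> F n) \<subseteq> F (n + 1)"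
    using D_degree[of "d - 1"] D_filtration by auto
  note completion_map_coset_family[OF filtered filtered D_add this assms]
  then show "completion_map D 1 (V d) F (coset_family (V (d - 1)) F v) =
      coset_family (V d) F (\<lambda>n. D (v (n - 1)))"
    and "coherent (V d) F (\<lambda>n. D (v (n - 1)))"
    by simp_all
qed

lemma coherent_H:
  assumes "coherent (V d) F v"
  shows "coherent (V (d - 1)) F (\<lambda>n. H (v (n + 1)))"
proof -
  have "\<And>n. H ` (V d \<inter> F n) \<subseteq> F (n + - 1)"
    using H_filtration by auto
  from completion_map_coset_family(2)[OF filtered filtered H_add H_degree this assms]
  show ?thesis
    by simp
qed

text \<open>The kernel of the completed differential in degree \<open>d\<close>.\<close>

definition completed_cycles_at :: "int \<Rightarrow> (int \<Rightarrow> 'v set) set" where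
  "completed_cycles_at d = {c \<in> completion (V d) F.
     completion_map D 1 (V (d + 1)) F c = completion_zero (V (d + 1)) F}"

lemma completed_cycles_at_iff:
  assumes "coherent (V d) F v"
  shows "coset_family (V d) F v \<in> completed_cycles_at d \<longleftrightarrow> (\<forall>n. D (v n) \<in> F (n + 1))"
proof -
  interpret V: filtered_group "V d" F by (rule filtered)
  interpret V': filtered_group "V (d + 1)" F by (rule filtered)
  have "coset_family (V d) F v \<in> completed_cycles_at d \<longleftrightarrow>
      coset_family (V (d + 1)) F (\<lambda>n. D (v (n - 1))) = coset_family (V (d + 1)) F (\<lambda>_. 0)"
    using assms completion_D(1)[of "d + 1" v]
    by (simp add: completed_cycles_at_def V.completion_eq V'.coset_family_zero)
  also have "\<dots> \<longleftrightarrow> (\<forall>n. D (v (n - 1)) \<in> F n)"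
    using assms completion_D(2)[of "d + 1" v] additive_subgroupD(1)[OF V'.subgroup_V]
    by (subst V'.coset_family_eq_iff) (auto simp: coherent_def)
  also have "\<dots> \<longleftrightarrow> (\<forall>n. D (v n) \<in> F (n + 1))"
    by (metis add_diff_cancel diff_add_cancel)
  finally show ?thesis .
qed

text \<open>The family \<open>n \<mapsto> H (v (n + 1))\<close> represents the completed homotopy applied to the class of \<open>v\<close>.
  It bounds a completed cycle, since \<open>v n - D (H (v n)) = H (D (v n))\<close> lies in \<open>F n\<close>.\<close>

lemma completed_D_H_cycle:
  assumes v: "coherent (V d) F v" and "coset_family (V d) F v \<in> completed_cycles_at d"
  shows "completion_map D 1 (V d) F (coset_family (V (d - 1)) F (\<lambda>n. H (v (n + 1)))) =
    coset_family (V d) F v"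
proof -
  interpret V: filtered_group "V d" F by (rule filtered)
  have "H (D (v n)) \<in> F n" for n
    using assms completed_cycles_at_iff[OF v] H_filtration[of "n + 1"] by auto
  then have "- H (D (v n)) \<in> F n" for n
    by (rule additive_subgroupD(3)[OF V.subgroup_F])
  moreover have "D (H (v n)) - v n = - H (D (v n))" for n
    using homotopy[of "v n"] by (simp add: algebra_simps)
  ultimately have "coset_family (V d) F (\<lambda>n. D (H (v n))) = coset_family (V d) F v"
    using v completion_D(2)[OF coherent_H[OF v]]
    by (subst V.coset_family_eq_iff) (auto simp: coherent_def)
  then show ?thesis
    by (simp add: completion_D(1)[OF coherent_H[OF v]])
qed

lemma completed_D_mem_cycles:
  assumes "coherent (V (d - 1)) F v"
  shows "completion_map D 1 (V d) F (coset_family (V (d - 1)) F v) \<in> completed_cycles_at d"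
proof -
  have "0 \<in> F n" for n
    using additive_subgroupD(1) filtered_group.subgroup_F[OF filtered] by blast
  then show ?thesis
    by (simp add: completion_D[OF assms] completed_cycles_at_iff D_D)
qed

lemma completed_cycles_eq_image:
  "completed_cycles_at d = completion_map D 1 (V d) F ` completion (V (d - 1)) F"
proof -
  interpret V: filtered_group "V d" F by (rule filtered)
  interpret V': filtered_group "V (d - 1)" F by (rule filtered)
  show ?thesis
  proof (intro subset_antisym subsetI)
    fix c assume c: "c \<in> completed_cycles_at d"
    then obtain v where v: "coherent (V d) F v" and cv: "c = coset_family (V d) F v"
      by (auto simp: completed_cycles_at_def V.completion_eq)
    then show "c \<in> completion_map D 1 (V d) F ` completion (V (d - 1)) F"
      using completed_D_H_cycle[OF v] coherent_H[OF v] c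
      by (metis V'.completion_eq image_eqI mem_Collect_eq)
  qed (auto simp: V'.completion_eq completed_D_mem_cycles)
qed

lemma completed_image_filtration:
  "completion_map D 1 (V d) F ` completion_filtration (V (d - 1)) F n =
    completed_cycles_at d \<inter> completion_filtration (V d) F (n + 1)"
proof -
  interpret V: filtered_group "V d" F by (rule filtered)
  interpret V': filtered_group "V (d - 1)" F by (rule filtered)
  show ?thesis
  proof (intro subset_antisym subsetI)
    fix c assume "c \<in> completion_map D 1 (V d) F ` completion_filtration (V (d - 1)) F n"
    then obtain b where b: "b \<in> completion_filtration (V (d - 1)) F n"
      and c: "c = completion_map D 1 (V d) F b"
      by auto
    from b obtain v where v: "coherent (V (d - 1)) F v" and bv: "b = coset_family (V (d - 1)) F v"
      by (auto simp: completion_filtration_def V'.completion_eq)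
    have "v n \<in> F n"
      using b bv V'.completion_filtration_iff[OF v] by simp
    then have "c \<in> completion_filtration (V d) F (n + 1)"
      using D_filtration[of n] completion_D[OF v] V.completion_filtration_iff
      by (auto simp: c bv)
    then show "c \<in> completed_cycles_at d \<inter> completion_filtration (V d) F (n + 1)"
      using completed_D_mem_cycles[OF v] by (simp add: c bv)
  next
    fix c assume c: "c \<in> completed_cycles_at d \<inter> completion_filtration (V d) F (n + 1)"
    then obtain v where v: "coherent (V d) F v" and cv: "c = coset_family (V d) F v"
      by (auto simp: completed_cycles_at_def V.completion_eq)
    have "H (v (n + 1)) \<in> F n"
      using c cv V.completion_filtration_iff[OF v] H_filtration[of "n + 1"] by auto
    then have "coset_family (V (d - 1)) F (\<lambda>n. H (v (n + 1))) \<in> completion_filtration (V (d - 1)) F n"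
      using V'.completion_filtration_iff[OF coherent_H[OF v]] by simp
    then show "c \<in> completion_map D 1 (V d) F ` completion_filtration (V (d - 1)) F n"
      using completed_D_H_cycle[OF v] c by (metis IntD1 cv image_eqI)
  qed
qed

text \<open>A coherent family that represents a completed cycle need not consist of cycles.  But its class
  is a boundary, and the boundary of a coherent family is a coherent family of cycles.\<close>

lemma completed_image_eq_completion_cycles:
  "completion_map D 1 (V d) F ` completion (V (d - 1)) F =
    completion_map id 0 (V d) F ` completion ({z. D z = 0} \<inter> V d) F"
proof -
  let ?Z = "{z. D z = 0} \<inter> V d"
  interpret V: filtered_group "V d" F by (rule filtered)
  interpret V': filtered_group "V (d - 1)" F by (rule filtered)
  have D_diff: "D (x - y) = D x - D y" for x y
    using D_add[of "x - y" y] by simp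
  have "additive_subgroup {z. D z = 0}"
    by (simp add: additive_subgroup_def D_zero D_diff)
  then interpret Z: filtered_group ?Z F
    by (intro filtered_group.intro additive_subgroup_Int V.subgroup_V V.subgroup_F V.mono_F)
  have incl: "completion_map id 0 (V d) F (coset_family ?Z F v) = coset_family (V d) F v"
      "coherent (V d) F v" if "coherent ?Z F v" for v
    using completion_map_coset_family[OF Z.filtered_group_axioms V.filtered_group_axioms,
        where f = id and s = 0 and v = v] that by auto
  show ?thesis
  proof (intro subset_antisym subsetI)
    fix c assume "c \<in> completion_map D 1 (V d) F ` completion (V (d - 1)) F"
    then obtain v where v: "coherent (V (d - 1)) F v"
      and c: "c = coset_family (V d) F (\<lambda>n. D (v (n - 1)))"
      by (auto simp: V'.completion_eq completion_D)
    have Dv: "coherent ?Z F (\<lambda>n. D (v (n - 1)))"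
      using completion_D(2)[OF v] by (simp add: coherent_def image_subset_iff D_D)
    then have "coset_family ?Z F (\<lambda>n. D (v (n - 1))) \<in> completion ?Z F"
      by (simp add: Z.completion_eq)
    then show "c \<in> completion_map id 0 (V d) F ` completion ?Z F"
      unfolding c incl(1)[OF Dv, symmetric] by (rule imageI)
  next
    fix c assume "c \<in> completion_map id 0 (V d) F ` completion ?Z F"
    then obtain v where v: "coherent ?Z F v" and c: "c = coset_family (V d) F v"
      by (auto simp: Z.completion_eq incl)
    have "D (v n) = 0" for n
      using v by (simp add: coherent_def image_subset_iff)
    then have "D (v n) \<in> F (n + 1)" for n
      using additive_subgroupD(1)[OF V.subgroup_F] by simp
    then show "c \<in> completion_map D 1 (V d) F ` completion (V (d - 1)) F"
      using completed_cycles_at_iff[OF incl(2)[OF v]] c by (simp flip: completed_cycles_eq_image)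
  qed
qed

end


section \<open>The contraction of the Tate construction\<close>

lemma sum_keys_supported:
  fixes g :: "'i \<Rightarrow> 'm::zero \<Rightarrow> 'v::comm_monoid_add"
  assumes "finite S" "\<And>m. g m 0 = 0" "\<And>m x. m \<notin> S \<Longrightarrow> g m x = 0"
  shows "(\<Sum>m \<in> Poly_Mapping.keys f. g m (Poly_Mapping.lookup f m)) =
    (\<Sum>m \<in> S. g m (Poly_Mapping.lookup f m))"
proof -
  have "(\<Sum>m \<in> Poly_Mapping.keys f. g m (Poly_Mapping.lookup f m)) =
      (\<Sum>m \<in> Poly_Mapping.keys f \<union> S. g m (Poly_Mapping.lookup f m))"
    using assms by (intro sum_keys_superset) auto
  also have "\<dots> = (\<Sum>m \<in> S. g m (Poly_Mapping.lookup f m))"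
    using assms by (intro sum.mono_neutral_right) auto
  finally show ?thesis .
qed

text \<open>The contracting homotopy: multiplication by \<open>u\<close> on the terms without \<open>u\<close>, and 0 on the terms
  with \<open>u\<close>.  For \<open>p = 2\<close> these are the even and the odd powers of \<open>u\<close>.\<close>

fun tate_homotopy_monomial :: "tate_monomial \<Rightarrow> 'm::zero \<Rightarrow> 'm tate" where
  "tate_homotopy_monomial (T r) x = UT r \<otimes>\<^sub>m x"
| "tate_homotopy_monomial (UT r) x = 0"

definition tate_homotopy :: "'m::ab_group_add tate \<Rightarrow> 'm tate" where
  "tate_homotopy f =
    (\<Sum>m \<in> Poly_Mapping.keys f. tate_homotopy_monomial m (Poly_Mapping.lookup f m))"

lemma lookup_tate_homotopy:
  "Poly_Mapping.lookup (tate_homotopy f) (T r) = 0"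
  "Poly_Mapping.lookup (tate_homotopy f) (UT r) = Poly_Mapping.lookup f (T r)"
proof -
  have "Poly_Mapping.lookup (tate_homotopy_monomial m x) (T r) = 0" for m and x :: 'a
    by (cases m) (simp_all add: lookup_single when_def)
  then show "Poly_Mapping.lookup (tate_homotopy f) (T r) = 0"
    by (simp add: tate_homotopy_def lookup_sum)
  have z: "Poly_Mapping.lookup (tate_homotopy_monomial m 0) (UT r) = (0 :: 'a)" for m
    by (cases m) simp_all
  have s: "Poly_Mapping.lookup (tate_homotopy_monomial m x) (UT r) = 0" if "m \<notin> {T r}" for m and x :: 'a
    using that by (cases m) (simp_all add: lookup_single when_def)
  show "Poly_Mapping.lookup (tate_homotopy f) (UT r) = Poly_Mapping.lookup f (T r)"
    using sum_keys_supported[of "{T r}" "\<lambda>m x. Poly_Mapping.lookup (tate_homotopy_monomial m x) (UT r)" f]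
      z s by (simp add: tate_homotopy_def lookup_sum)
qed

lemma tate_homotopy_single: "tate_homotopy (m \<otimes>\<^sub>m x) = tate_homotopy_monomial m x"
  by (cases "x = 0"; cases m) (simp_all add: tate_homotopy_def)

lemma tate_mapping_eqI:
  assumes "\<And>r. Poly_Mapping.lookup f (T r) = Poly_Mapping.lookup g (T r)"
    and "\<And>r. Poly_Mapping.lookup f (UT r) = Poly_Mapping.lookup g (UT r)"
  shows "f = g"
  by (rule poly_mapping_eqI, rename_tac m, case_tac m) (simp_all add: assms)

context steenrod_module_with_differential
begin

sublocale sigma: Vector_Spaces.linear scale scale \<sigma>
  by (rule linear_\<sigma>)

sublocale Tate: vector_space "tate_scale scale"
  by (rule vector_space_tate)

lemma lookup_sigma_bar:
  "Poly_Mapping.lookup (sigma_bar \<sigma> f) (T r) =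
    \<sigma> (Poly_Mapping.lookup f (T r)) + Poly_Mapping.lookup f (UT r)"
  "Poly_Mapping.lookup (sigma_bar \<sigma> f) (UT r) = - \<sigma> (Poly_Mapping.lookup f (UT r))"
proof -
  have z: "sigma_bar_monomial \<sigma> m 0 = 0" for m
    by (cases m) (simp_all add: sigma.zero)
  have s: "Poly_Mapping.lookup (sigma_bar_monomial \<sigma> m x) k = 0"
    if "k \<in> {T r, UT r}" "m \<notin> {T r, UT r}" for m x k
    using that by (cases m) (auto simp: lookup_single lookup_minus when_def)
  have "Poly_Mapping.lookup (sigma_bar \<sigma> f) k =
      (\<Sum>m \<in> {T r, UT r}. Poly_Mapping.lookup (sigma_bar_monomial \<sigma> m (Poly_Mapping.lookup f m)) k)"
    if "k \<in> {T r, UT r}" for k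
    using sum_keys_supported[of "{T r, UT r}"
        "\<lambda>m x. Poly_Mapping.lookup (sigma_bar_monomial \<sigma> m x) k" f] z s[OF that]
    by (simp add: sigma_bar_def lookup_sum)
  then show "Poly_Mapping.lookup (sigma_bar \<sigma> f) (T r) =
      \<sigma> (Poly_Mapping.lookup f (T r)) + Poly_Mapping.lookup f (UT r)"
    "Poly_Mapping.lookup (sigma_bar \<sigma> f) (UT r) = - \<sigma> (Poly_Mapping.lookup f (UT r))"
    by (simp_all add: lookup_single lookup_minus when_def)
qed

lemma linear_sigma_bar:
  "Vector_Spaces.linear (tate_scale scale) (tate_scale scale) (sigma_bar \<sigma>)"
  unfolding Vector_Spaces.linear_iff
  by (intro conjI allI vector_space_tate tate_mapping_eqI)
    (simp_all add: lookup_sigma_bar lookup_add sigma.add sigma.scale scale_right_distrib)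

lemma linear_tate_homotopy:
  "Vector_Spaces.linear (tate_scale scale) (tate_scale scale) tate_homotopy"
  unfolding Vector_Spaces.linear_iff
  by (intro conjI allI vector_space_tate tate_mapping_eqI)
    (simp_all add: lookup_tate_homotopy lookup_add)

lemma sigma_bar_sigma_bar: "sigma_bar \<sigma> (sigma_bar \<sigma> f) = 0"
  by (rule tate_mapping_eqI) (simp_all add: lookup_sigma_bar sigma.add sigma.neg \<sigma>_\<sigma>)

lemma sigma_bar_homotopy: "sigma_bar \<sigma> (tate_homotopy f) + tate_homotopy (sigma_bar \<sigma> f) = f"
  by (rule tate_mapping_eqI)
    (simp_all add: lookup_sigma_bar lookup_tate_homotopy lookup_add sigma.zero)

lemma linear_image_span_subset:
  assumes "Vector_Spaces.linear (tate_scale scale) (tate_scale scale) L"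
    and "\<And>b. b \<in> B \<Longrightarrow> L b \<in> tate_span scale B'"
  shows "L ` tate_span scale B \<subseteq> tate_span scale B'"
proof -
  interpret L: Vector_Spaces.linear "tate_scale scale" "tate_scale scale" L
    by (rule assms(1))
  have "L ` tate_span scale B = tate_span scale (L ` B)"
    by (rule L.span_image[symmetric])
  also have "\<dots> \<subseteq> tate_span scale B'"
    using assms(2) by (intro Tate.span_minimal Tate.subspace_span) auto
  finally show ?thesis .
qed

lemma tate_part_monomial:
  "x \<in> M k \<Longrightarrow> monomial_degree m + k = d \<Longrightarrow> m \<otimes>\<^sub>m x \<in> tate_part scale M d"
  unfolding tate_part_def by (rule Tate.span_base) blast

lemma tate_filtration_monomial:
  "x \<in> M k \<Longrightarrow> monomial_degree m - k * (int CARD('p) - 1) \<le> n \<Longrightarrow>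
    m \<otimes>\<^sub>m x \<in> tate_filtration scale M n"
  unfolding tate_filtration_def by (rule Tate.span_base) blast

lemma subspace_tate_part: "Tate.subspace (tate_part scale M d)"
  unfolding tate_part_def by (rule Tate.subspace_span)

lemma subspace_tate_filtration: "Tate.subspace (tate_filtration scale M n)"
  unfolding tate_filtration_def by (rule Tate.subspace_span)

lemma sigma_bar_tate_part: "sigma_bar \<sigma> ` tate_part scale M d \<subseteq> tate_part scale M (d + 1)"
proof -
  have "sigma_bar \<sigma> (m \<otimes>\<^sub>m x) \<in> tate_part scale M (d + 1)"
    if x: "x \<in> M k" and d: "monomial_degree m + k = d" for m x k
  proof (cases m)
    case (T r)
    then show ?thesis
      using d \<sigma>_degree[OF x] by (auto simp: sigma_bar_monomial_tensor intro: tate_part_monomial)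
  next
    case (UT r)
    have "T r \<otimes>\<^sub>m x \<in> tate_part scale M (d + 1)" "UT r \<otimes>\<^sub>m \<sigma> x \<in> tate_part scale M (d + 1)"
      using UT d by (auto intro!: tate_part_monomial[OF x] tate_part_monomial[OF \<sigma>_degree[OF x]])
    then show ?thesis
      using UT Tate.subspace_diff[OF subspace_tate_part] by (simp add: sigma_bar_monomial_tensor)
  qed
  then show ?thesis
    unfolding tate_part_def by (intro linear_image_span_subset linear_sigma_bar) blast
qed

lemma tate_homotopy_tate_part: "tate_homotopy ` tate_part scale M d \<subseteq> tate_part scale M (d - 1)"
proof -
  have "tate_homotopy (m \<otimes>\<^sub>m x) \<in> tate_part scale M (d - 1)"
    if x: "x \<in> M k" and d: "monomial_degree m + k = d" for m x k
    using d Tate.subspace_0[OF subspace_tate_part]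
    by (cases m) (auto simp: tate_homotopy_single intro!: tate_part_monomial[OF x])
  then show ?thesis
    unfolding tate_part_def by (intro linear_image_span_subset linear_tate_homotopy) blast
qed

text \<open>On the terms \<open>m \<otimes> \<sigma> x\<close> the filtration does not rise at all, since \<open>p - 1 \<ge> 0\<close>; it rises by 1
  where \<open>u t\<^sup>r\<close> is replaced by \<open>t\<^sup>r\<close>.\<close>

lemma sigma_bar_tate_filtration:
  "sigma_bar \<sigma> ` tate_filtration scale M n \<subseteq> tate_filtration scale M (n + 1)"
proof -
  have p: "(k + 1) * (int CARD('p) - 1) \<ge> k * (int CARD('p) - 1)" for k
    by (intro mult_right_mono) (simp_all add: Suc_le_eq)
  have "sigma_bar \<sigma> (m \<otimes>\<^sub>m x) \<in> tate_filtration scale M (n + 1)"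
    if x: "x \<in> M k" and n: "monomial_degree m - k * (int CARD('p) - 1) \<le> n" for m x k
  proof -
    have \<sigma>x: "m \<otimes>\<^sub>m \<sigma> x \<in> tate_filtration scale M (n + 1)"
      using n p[of k] by (intro tate_filtration_monomial[OF \<sigma>_degree[OF x]]) linarith
    show ?thesis
    proof (cases m)
      case (T r)
      then show ?thesis
        using \<sigma>x by (simp add: sigma_bar_monomial_tensor)
    next
      case (UT r)
      have "T r \<otimes>\<^sub>m x \<in> tate_filtration scale M (n + 1)"
        using UT n by (intro tate_filtration_monomial[OF x]) simp
      then show ?thesis
        using UT \<sigma>x Tate.subspace_diff[OF subspace_tate_filtration]
        by (simp add: sigma_bar_monomial_tensor)
    qed
  qed
  then show ?thesis
    unfolding tate_filtration_def by (intro linear_image_span_subset linear_sigma_bar) blast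
qed

lemma tate_homotopy_tate_filtration:
  "tate_homotopy ` tate_filtration scale M n \<subseteq> tate_filtration scale M (n - 1)"
proof -
  have "tate_homotopy (m \<otimes>\<^sub>m x) \<in> tate_filtration scale M (n - 1)"
    if x: "x \<in> M k" and n: "monomial_degree m - k * (int CARD('p) - 1) \<le> n" for m x k
    using n Tate.subspace_0[OF subspace_tate_filtration]
    by (cases m) (auto simp: tate_homotopy_single intro!: tate_filtration_monomial[OF x])
  then show ?thesis
    unfolding tate_filtration_def by (intro linear_image_span_subset linear_tate_homotopy) blast
qed

sublocale contraction: filtered_contraction "tate_part scale M" "tate_filtration scale M"
  "sigma_bar \<sigma>" tate_homotopy
proof unfold_locales
  have subgroup: "additive_subgroup U" if "Tate.subspace U" for U
    using that by (simp add: additive_subgroup_def Tate.subspace_0 Tate.subspace_diff)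
  show "additive_subgroup (tate_part scale M d)" for d
    by (intro subgroup subspace_tate_part)
  show "additive_subgroup (tate_filtration scale M n)" for n
    by (intro subgroup subspace_tate_filtration)
  show "tate_filtration scale M n \<subseteq> tate_filtration scale M m" if "n \<le> m" for n m
    unfolding tate_filtration_def using that by (intro Tate.span_mono) force
  show "sigma_bar \<sigma> (f + g) = sigma_bar \<sigma> f + sigma_bar \<sigma> g" for f g
    using linear_sigma_bar by (simp add: Vector_Spaces.linear_iff)
  show "tate_homotopy (f + g) = tate_homotopy f + tate_homotopy g" for f g :: "'m tate"
    using linear_tate_homotopy by (simp add: Vector_Spaces.linear_iff)
qed (use sigma_bar_tate_part tate_homotopy_tate_part sigma_bar_tate_filtration
    tate_homotopy_tate_filtration sigma_bar_sigma_bar sigma_bar_homotopy in auto)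

lemma tate_span_monomials: "tate_span scale {m \<otimes>\<^sub>m x | m x k. x \<in> M k} = UNIV"
proof -
  let ?S = "tate_span scale {m \<otimes>\<^sub>m x | m x k. x \<in> M k}"
  have "m \<otimes>\<^sub>m x \<in> ?S" for m x
  proof -
    obtain g :: "int \<Rightarrow>\<^sub>0 'm" where g: "\<And>n. Poly_Mapping.lookup g n \<in> M n"
      and x: "x = (\<Sum>n \<in> Poly_Mapping.keys g. Poly_Mapping.lookup g n)"
      using direct_sum[of x] by blast
    have "m \<otimes>\<^sub>m (\<Sum>n \<in> N. Poly_Mapping.lookup g n) =
        (\<Sum>n \<in> N. m \<otimes>\<^sub>m Poly_Mapping.lookup g n)" for N
      by (induction N rule: infinite_finite_induct) (simp_all add: single_add)
    moreover have "m \<otimes>\<^sub>m Poly_Mapping.lookup g n \<in> ?S" for n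
      using g by (intro Tate.span_base) blast
    ultimately show ?thesis
      unfolding x by (simp add: Tate.span_sum)
  qed
  then have "(\<Sum>m \<in> Poly_Mapping.keys f. m \<otimes>\<^sub>m Poly_Mapping.lookup f m) \<in> ?S" for f
    by (intro Tate.span_sum)
  then show ?thesis
    by (auto simp: poly_mapping_sum_singles)
qed

lemma range_sigma_bar: "range (sigma_bar \<sigma>) = sigma_bar_cycles scale M \<sigma>"
proof -
  interpret D: Vector_Spaces.linear "tate_scale scale" "tate_scale scale" "sigma_bar \<sigma>"
    by (rule linear_sigma_bar)
  let ?B = "{m \<otimes>\<^sub>m x | m x k. x \<in> M k}"
  let ?C = "{T r \<otimes>\<^sub>m x - UT r \<otimes>\<^sub>m \<sigma> x | r x k. x \<in> M k}"
  have "sigma_bar \<sigma> ` ?B = ?C"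
  proof
    show "?C \<subseteq> sigma_bar \<sigma> ` ?B"
    proof
      fix f assume "f \<in> ?C"
      then obtain r x k where x: "x \<in> M k" and f: "f = T r \<otimes>\<^sub>m x - UT r \<otimes>\<^sub>m \<sigma> x"
        by blast
      then have "f = sigma_bar \<sigma> (UT r \<otimes>\<^sub>m x)"
        by (simp add: sigma_bar_monomial_tensor)
      then show "f \<in> sigma_bar \<sigma> ` ?B"
        using x by blast
    qed
    show "sigma_bar \<sigma> ` ?B \<subseteq> ?C"
    proof
      fix f assume "f \<in> sigma_bar \<sigma> ` ?B"
      then obtain m x k where x: "x \<in> M k" and f: "f = sigma_bar \<sigma> (m \<otimes>\<^sub>m x)"
        by blast
      show "f \<in> ?C"
      proof (cases m)
        case (T r)
        \<comment> \<open>the second term vanishes because \<open>\<sigma>\<close> squares to 0\<close>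
        then have "f = T r \<otimes>\<^sub>m \<sigma> x - UT r \<otimes>\<^sub>m \<sigma> (\<sigma> x)"
          by (simp add: f sigma_bar_monomial_tensor \<sigma>_\<sigma>)
        then show ?thesis
          using \<sigma>_degree[OF x] by blast
      next
        case (UT r)
        then have "f = T r \<otimes>\<^sub>m x - UT r \<otimes>\<^sub>m \<sigma> x"
          by (simp add: f sigma_bar_monomial_tensor)
        then show ?thesis
          using x by blast
      qed
    qed
  qed
  then show ?thesis
    unfolding sigma_bar_cycles_def tate_span_monomials[symmetric]
    by (metis D.span_image)
qed

end


section \<open>Exactness before and after completion\<close>

theorem lemma9p3:
  fixes scale :: "'p::prime_card mod_ring \<Rightarrow> 'm::ab_group_add \<Rightarrow> 'm"
    and M :: "int \<Rightarrow> 'm set"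
    and act :: "'m \<Rightarrow> 'p steenrod \<Rightarrow> 'm"
    and \<sigma> :: "'m \<Rightarrow> 'm"
  assumes "steenrod_module_with_differential scale M act \<sigma>"
  shows
    "(\<forall>n. sigma_bar \<sigma> ` tate_filtration scale M n
          = {f. sigma_bar \<sigma> f = 0} \<inter> tate_filtration scale M (n + 1)) \<and>
     {f. sigma_bar \<sigma> f = 0} = range (sigma_bar \<sigma>) \<and>
     range (sigma_bar \<sigma>) = sigma_bar_cycles scale M \<sigma> \<and>
     (\<forall>d n. completed_sigma_bar scale M \<sigma> d ` R_plus_filtration scale M (d - 1) n
          = completed_kernel scale M \<sigma> d \<inter> R_plus_filtration scale M d (n + 1)) \<and>
     (\<forall>d. completed_kernel scale M \<sigma> d = completed_sigma_bar scale M \<sigma> d ` R_plus scale M (d - 1)) \<and>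
     (\<forall>d. completed_sigma_bar scale M \<sigma> d ` R_plus scale M (d - 1) = completed_cycles scale M \<sigma> d)"
proof -
  interpret steenrod_module_with_differential scale M act \<sigma>
    by (rule assms)
  have kernel: "completed_kernel scale M \<sigma> d = contraction.completed_cycles_at d" for d
    by (simp add: completed_kernel_def contraction.completed_cycles_at_def R_plus_def
        completed_sigma_bar_def)
  have cycles: "sigma_bar_cycles scale M \<sigma> = {f. sigma_bar \<sigma> f = 0}"
    by (simp only: contraction.cycles_eq_range range_sigma_bar)
  show ?thesis
  proof (intro conjI allI)
    show "sigma_bar \<sigma> ` tate_filtration scale M n
        = {f. sigma_bar \<sigma> f = 0} \<inter> tate_filtration scale M (n + 1)" for n
      by (rule contraction.image_filtration)
    show "{f. sigma_bar \<sigma> f = 0} = range (sigma_bar \<sigma>)"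
      by (rule contraction.cycles_eq_range)
    show "range (sigma_bar \<sigma>) = sigma_bar_cycles scale M \<sigma>"
      by (rule range_sigma_bar)
    show "completed_sigma_bar scale M \<sigma> d ` R_plus_filtration scale M (d - 1) n
        = completed_kernel scale M \<sigma> d \<inter> R_plus_filtration scale M d (n + 1)" for d n
      unfolding kernel completed_sigma_bar_def R_plus_filtration_def
      by (rule contraction.completed_image_filtration)
    show "completed_kernel scale M \<sigma> d = completed_sigma_bar scale M \<sigma> d ` R_plus scale M (d - 1)" for d
      unfolding kernel completed_sigma_bar_def R_plus_def
      by (rule contraction.completed_cycles_eq_image)
    show "completed_sigma_bar scale M \<sigma> d ` R_plus scale M (d - 1) = completed_cycles scale M \<sigma> d" for d
      unfolding completed_sigma_bar_def R_plus_def completed_cycles_def cycles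
      by (rule contraction.completed_image_eq_completion_cycles)
  qed
qed

end
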